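(* Suppose that $p$ is a prime with $p\nmid a_{11}a_{22}a_{33}d$. (1) If $p\nmid D$, then $p>2$, and the number of solutions $(x,y,z)\in(\mathbb{Z}/p\mathbb{Z})^3$ of $$a_{11}x^2+a_{22}y^2+a_{33}z^2+a_{12}xy+a_{13}xz+a_{23}yz\equiv dxyz \pmod p$$ equals $$p^2+\left(\left(\frac{-A_{11}}{p}\right)_K+\left(\frac{-A_{22}}{p}\right)_K+\left(\frac{-A_{33}}{p}\right)_K\right)\cdot p+1.$$ (2) If $2<p\mid D$ and at least two of $A_{11}, A_{22}, A_{33}$ are divisible by $p$, then the solution number is $p^2+1$. (3) If $2<p\mid D$ and at most one of $A_{11}, A_{22}, A_{33}$ is divisible by $p$, then the solution number is $$p^2+\left(\left(\frac{-A_{11}}{p}\right)_K+\left(\frac{-A_{22}}{p}\right)_K+\left(\frac{-A_{33}}{p}\right)_K-\left(\frac{-A_{jj}}{p}\right)_K\right)\cdot p+1,$$ where $1\leq j\leq 3$ is any index such that $p\nmid A_{jj}$. (4) If $2=p\mid D$, then the solution number is $5$ if $a_{12}\equiv a_{13}\equiv a_{23}\equiv 0\pmod 2$; $1$ if $a_{12}\equiv a_{13}\equiv a_{23}\equiv 1\pmod 2$; and $3$ otherwise.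
   Context: Let $a_{11},a_{22},a_{33},a_{12},a_{13},a_{23},d$ be integers, and consider the Diophantine equation $a_{11}x^2+a_{22}y^2+a_{33}z^2+a_{12}xy+a_{13}xz+a_{23}yz=dxyz$ over $\mathbb{F}_p$. Set $$G=\begin{pmatrix}2a_{11}&a_{12}&a_{13}\\ a_{12}&2a_{22}&a_{23}\\ a_{13}&a_{23}&2a_{33}\end{pmatrix},$$ $A_{11}=4a_{22}a_{33}-a_{23}^2$, $A_{22}=4a_{11}a_{33}-a_{13}^2$, $A_{33}=4a_{11}a_{22}-a_{12}^2$, and $D=\det(G)$. Here $\left(\frac{m}{n}\right)_K$ denotes the Kronecker–Jacobi symbol (Legendre symbol for odd prime $n$). *)

theory Defs
  imports "HOL-Analysis.Determinants" "HOL-Number_Theory.Residues"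
begin

definition coeff_matrix :: "int \<Rightarrow> int \<Rightarrow> int \<Rightarrow> int \<Rightarrow> int \<Rightarrow> int \<Rightarrow> int^3^3" where
  "coeff_matrix a11 a22 a33 a12 a13 a23 =
     vector [vector [2 * a11, a12, a13],
             vector [a12, 2 * a22, a23],
             vector [a13, a23, 2 * a33]]"

text \<open>Component \<open>j\<close> is the principal minor \<open>A\<^sub>j\<^sub>j\<close> of the coefficient matrix. Kronecker symbols of
  the numbers \<open>-A\<^sub>j\<^sub>j\<close> occur only over odd primes, where they are Legendre symbols.\<close>

definition diag_minors :: "int \<Rightarrow> int \<Rightarrow> int \<Rightarrow> int \<Rightarrow> int \<Rightarrow> int \<Rightarrow> int^3" where
  "diag_minors a11 a22 a33 a12 a13 a23 =
     vector [4 * a22 * a33 - a23\<^sup>2, 4 * a11 * a33 - a13\<^sup>2, 4 * a11 * a22 - a12\<^sup>2]"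

text \<open>Residue classes modulo \<open>p\<close> are represented by the integers in \<open>{0..<p}\<close>.\<close>

definition solutions_mod ::
    "int \<Rightarrow> int \<Rightarrow> int \<Rightarrow> int \<Rightarrow> int \<Rightarrow> int \<Rightarrow> int \<Rightarrow> nat \<Rightarrow> (int \<times> int \<times> int) set" where
  "solutions_mod a11 a22 a33 a12 a13 a23 d p =
     {(x, y, z). x \<in> {0..<int p} \<and> y \<in> {0..<int p} \<and> z \<in> {0..<int p} \<and>
        [a11 * x\<^sup>2 + a22 * y\<^sup>2 + a33 * z\<^sup>2 + a12 * x * y + a13 * x * z + a23 * y * z
           = d * x * y * z] (mod int p)}"

end

theory Submission
  imports Defs "HOL-Number_Theory.Euler_Criterion"
begin

text \<open>For odd \<open>p\<close> the equation is quadratic in \<open>x\<close>, so the number of solutions is \<open>p\<^sup>2\<close> plus the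
  sum over \<open>y, z\<close> of the quadratic character of its discriminant. For \<open>z \<noteq> 0\<close>, substituting
  \<open>z y\<close> for \<open>y\<close> turns the sum over \<open>y\<close> into a sum over a quadratic polynomial in \<open>y\<close> whose
  coefficients depend only on \<open>b = a12 - d z\<close>. It is minus the character of the leading coefficient
  \<open>b\<^sup>2 - 4 a11 a22\<close>, plus \<open>p\<close> times a correction if \<open>G\<close> with \<open>b\<close> in place of \<open>a12\<close> is singular.
  Summed over all \<open>b\<close>, the corrections add up to the characters of \<open>-A\<^sub>1\<^sub>1\<close> and \<open>-A\<^sub>2\<^sub>2\<close>, because the
  determinant is a quadratic polynomial in \<open>b\<close> of discriminant \<open>4 A\<^sub>1\<^sub>1 A\<^sub>2\<^sub>2\<close>. The slice \<open>z = 0\<close>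
  contributes the character of \<open>-A\<^sub>3\<^sub>3\<close>, and the correction at the missing value \<open>b = a12\<close> is nonzero
  only if \<open>p\<close> divides \<open>D\<close>.\<close>

section \<open>Solution counts as indicator sums, and the prime 2\<close>

lemma card_solutions_mod_eq_sum:
  "int (card (solutions_mod a11 a22 a33 a12 a13 a23 d p)) =
    (\<Sum>x\<in>{0..<int p}. \<Sum>y\<in>{0..<int p}. \<Sum>z\<in>{0..<int p}. of_bool (int p dvd
      a11 * x\<^sup>2 + a22 * y\<^sup>2 + a33 * z\<^sup>2 + a12 * x * y + a13 * x * z + a23 * y * z - d * x * y * z))"
    (is "_ = (\<Sum>x\<in>?R. \<Sum>y\<in>?R. \<Sum>z\<in>?R. of_bool (?P x y z))")
proof -
  have "solutions_mod a11 a22 a33 a12 a13 a23 d p =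
      {t \<in> ?R \<times> ?R \<times> ?R. ?P (fst t) (fst (snd t)) (snd (snd t))}"
    unfolding solutions_mod_def cong_iff_dvd_diff by auto
  then have "int (card (solutions_mod a11 a22 a33 a12 a13 a23 d p)) =
      (\<Sum>t\<in>?R \<times> ?R \<times> ?R. of_bool (?P (fst t) (fst (snd t)) (snd (snd t))))"
    by (simp add: Int_def)
  also have "\<dots> = (\<Sum>x\<in>?R. \<Sum>y\<in>?R. \<Sum>z\<in>?R. of_bool (?P x y z))"
    by (simp only: sum.cartesian_product case_prod_unfold fst_conv snd_conv)
  finally show ?thesis .
qed

lemma card_Collect_3: "card {j::3. P j} = of_bool (P 1) + of_bool (P 2) + of_bool (P 3)"
proof -
  have "card {j::3. P j} = (\<Sum>j\<in>UNIV. of_bool (P j))" by simp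
  then show ?thesis by (simp only: sum_3)
qed

text \<open>Written as a polynomial in \<open>a12\<close>, the bracket is what later becomes
  \<open>half_det a12\<close>. The factor 2 makes the determinant even, so p = 2 always divides
  it.\<close>

lemma det_coeff_matrix:
  "det (coeff_matrix a11 a22 a33 a12 a13 a23) =
    - 2 * (a33 * a12\<^sup>2 - a13 * a23 * a12 + (a11 * a23\<^sup>2 + a22 * a13\<^sup>2 - 4 * a11 * a22 * a33))"
  by (simp add: coeff_matrix_def det_3 power2_eq_square algebra_simps)

lemma card_solutions_mod_2:
  assumes "odd a11" "odd a22" "odd a33" "odd d"
  shows "int (card (solutions_mod a11 a22 a33 a12 a13 a23 d 2)) =
    (if even a12 \<and> even a13 \<and> even a23 then 5
     else if odd a12 \<and> odd a13 \<and> odd a23 then 1 else 3)"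
proof -
  have R: "{0..<int 2} = {0, 1}" by auto
  show ?thesis
    \<comment> \<open>Without \<open>sum_of_bool_eq\<close> the eight terms stay explicit instead of
      turning back into cardinalities.\<close>
    unfolding card_solutions_mod_eq_sum R using assms by (simp del: sum_of_bool_eq)
qed

section \<open>Quadratic character and character sums modulo an odd prime\<close>

locale odd_prime_modulus =
  fixes p :: int
  assumes prime_p: "prime p" and p_gt_2: "2 < p"
begin

abbreviation chi :: "int \<Rightarrow> int" where "chi a \<equiv> Legendre a p"

abbreviation residues_p :: "int set" where "residues_p \<equiv> {0..<p}"

lemma dvd_mult_iff: "p dvd a * b \<longleftrightarrow> p dvd a \<or> p dvd b"
  using prime_p by (simp add: prime_dvd_mult_iff)

lemma dvd_power2_iff: "p dvd a\<^sup>2 \<longleftrightarrow> p dvd a"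
  by (simp add: power2_eq_square dvd_mult_iff)

lemma not_dvd_2: "\<not> p dvd 2"
  using p_gt_2 zdvd_imp_le by fastforce

lemma not_dvd_4: "\<not> p dvd 4"
  using not_dvd_2 dvd_mult_iff[of 2 2] by simp

lemma not_dvd_1: "\<not> p dvd 1"
  using p_gt_2 zdvd_imp_le by fastforce

lemma dvd_iff_of_dvd_diff: "p dvd a - b \<Longrightarrow> p dvd a \<longleftrightarrow> p dvd b" for a b :: int
  by (metis cong_dvd_iff cong_iff_dvd_diff)

lemma chi_cong: "p dvd a - b \<Longrightarrow> chi a = chi b"
  by (simp add: Legendre_def QuadRes_def cong_def mod_eq_dvd_iff [symmetric])

lemma chi_mod [simp]: "chi (a mod p) = chi a"
  by (intro chi_cong) (simp add: mod_eq_dvd_iff [symmetric])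

lemma chi_eq_0_iff: "chi a = 0 \<longleftrightarrow> p dvd a"
  by (simp add: Legendre_def cong_0_iff)

lemma chi_cases: "chi a = -1 \<or> chi a = 0 \<or> chi a = 1"
  by (simp add: Legendre_def)

text \<open>Such values differ by at most 2 < p. In \<open>chi_mult\<close> this lifts the
  congruence from Euler's criterion to an equality.\<close>

lemma eq_of_dvd_diff_chi:
  assumes "p dvd u - v" "u \<in> {-1, 0, 1}" "v \<in> {-1, 0, 1}"
  shows "u = v"
proof (rule ccontr)
  assume "u \<noteq> v"
  then have "p \<le> \<bar>u - v\<bar>" using assms(1) dvd_imp_le_int[of "u - v" p] p_gt_2 by simp
  then show False using assms p_gt_2 by auto
qed

lemma chi_mult: "chi (a * b) = chi a * chi b"
proof -
  define k where "k = (nat p - 1) div 2"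
  have euler: "[chi c = c ^ k] (mod p)" for c
    using euler_criterion[of "nat p" c] prime_p p_gt_2 by (simp add: k_def)
  have "[chi (a * b) = chi a * chi b] (mod p)"
    using euler[of "a * b"] cong_mult[OF euler[of a] euler[of b]]
    by (metis cong_sym cong_trans power_mult_distrib)
  then have "p dvd chi (a * b) - chi a * chi b"
    by (simp add: cong_iff_dvd_diff)
  then show ?thesis
    using chi_cases[of a] chi_cases[of b] chi_cases[of "a * b"]
    by (intro eq_of_dvd_diff_chi) auto
qed

lemma chi_power2: "\<not> p dvd a \<Longrightarrow> chi (a\<^sup>2) = 1"
  using chi_cases[of a] chi_eq_0_iff[of a] by (auto simp: power2_eq_square chi_mult)

lemma chi_eqI:
  assumes "p dvd s\<^sup>2 * u - t\<^sup>2 * v" "\<not> p dvd s" "\<not> p dvd t"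
  shows "chi u = chi v"
  using chi_cong[OF assms(1)] assms(2,3) by (simp add: chi_mult chi_power2)

text \<open>The product is a nonzero square modulo p, so \<open>chi u * chi v = 1\<close>.\<close>

lemma chi_eq_of_mult_square:
  assumes "p dvd u * v - w\<^sup>2" "\<not> p dvd u" "\<not> p dvd v"
  shows "chi u = chi v"
proof -
  have "\<not> p dvd w\<^sup>2" using dvd_iff_of_dvd_diff[OF assms(1)] assms by (simp add: dvd_mult_iff)
  then have "chi (u * v) = 1"
    using chi_cong[OF assms(1)] chi_power2 by (simp add: dvd_power2_iff)
  then show ?thesis using chi_cases[of u] chi_cases[of v] by (auto simp: chi_mult)
qed

lemma affine_bij_betw:
  assumes "\<not> p dvd a"
  shows "bij_betw (\<lambda>x. (a * x + b) mod p) residues_p residues_p"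
proof -
  have "inj_on (\<lambda>x. (a * x + b) mod p) residues_p"
  proof (rule inj_onI)
    fix x y assume xy: "x \<in> residues_p" "y \<in> residues_p"
      and "(a * x + b) mod p = (a * y + b) mod p"
    then have "p dvd a * (x - y)" by (simp add: mod_eq_dvd_iff algebra_simps)
    then have "p dvd x - y" using assms by (simp add: dvd_mult_iff)
    then have "x mod p = y mod p" by (simp add: mod_eq_dvd_iff)
    then show "x = y" using xy by simp
  qed
  moreover have "(\<lambda>x. (a * x + b) mod p) ` residues_p \<subseteq> residues_p"
    using p_gt_2 by auto
  ultimately show ?thesis
    by (simp add: bij_betw_def endo_inj_surj)
qed

text \<open>Since \<open>f\<close> depends only on the residue class, an affine permutation of the
  residues can be applied without reducing its values.\<close>

lemma sum_affine:
  fixes f :: "int \<Rightarrow> int"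
  assumes "\<And>x. f (x mod p) = f x" "\<not> p dvd a"
  shows "(\<Sum>x\<in>residues_p. f (a * x + b)) = sum f residues_p"
  using sum.reindex_bij_betw[OF affine_bij_betw[OF assms(2)], of f b] assms(1) by simp

lemma sum_of_bool_dvd: "(\<Sum>x\<in>residues_p. of_bool (p dvd x)) = (1 :: int)"
proof -
  have "{x \<in> residues_p. p dvd x} = {0}"
    using p_gt_2 by (auto dest: zdvd_imp_le simp: le_less)
  then show ?thesis by (simp add: of_bool_def sum.If_cases Int_def conj_commute)
qed

lemma dvd_mod_p_iff [simp]: "p dvd x mod p \<longleftrightarrow> p dvd x"
  by (simp add: dvd_mod_iff)

lemma cong_mod_p: "[x mod p = x] (mod p)"
  by (simp add: cong_def)

lemma sum_of_bool_square:
  "(\<Sum>x\<in>residues_p. of_bool (p dvd x\<^sup>2 - k)) = 1 + chi k"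
proof -
  consider "p dvd k" | "\<not> p dvd k" "chi k = -1" | "\<not> p dvd k" "chi k = 1"
    using chi_cases[of k] chi_eq_0_iff[of k] by blast
  then show ?thesis
  proof cases
    case 1
    then have "p dvd x\<^sup>2 - k \<longleftrightarrow> p dvd x" for x
      using dvd_power2_iff[of x] dvd_iff_of_dvd_diff[of "x\<^sup>2 - k" "x\<^sup>2"] by simp
    then show ?thesis using 1 chi_eq_0_iff[of k] sum_of_bool_dvd by simp
  next
    case 2
    then have "\<not> p dvd x\<^sup>2 - k" for x
      by (auto simp: Legendre_def QuadRes_def cong_iff_dvd_diff split: if_splits)
    then show ?thesis using 2 by simp
  next
    case 3
    then obtain y where y: "p dvd y\<^sup>2 - k"
      by (auto simp: Legendre_def QuadRes_def cong_iff_dvd_diff split: if_splits)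
    have ny: "\<not> p dvd y" using y 3 dvd_iff_of_dvd_diff[OF y] dvd_power2_iff[of y] by simp
    have split: "p dvd x\<^sup>2 - k \<longleftrightarrow> p dvd x + y \<or> p dvd x - y" for x
    proof -
      have "p dvd x\<^sup>2 - k \<longleftrightarrow> p dvd (x + y) * (x - y)"
        by (rule dvd_iff_of_dvd_diff)
          (use y in \<open>simp add: algebra_simps power2_eq_square\<close>)
      then show ?thesis by (simp only: dvd_mult_iff)
    qed
    \<comment> \<open>Both factors vanishing would force p to divide 2 y. So the two roots are
      distinct and the indicator splits into a sum.\<close>
    have "\<not> (p dvd x + y \<and> p dvd x - y)" for x
    proof
      assume "p dvd x + y \<and> p dvd x - y"
      then have "p dvd (x + y) - (x - y)" using dvd_diff by blast
      then show False using ny not_dvd_2 dvd_mult_iff[of 2 y] by simp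
    qed
    then have "of_bool (p dvd x\<^sup>2 - k) = of_bool (p dvd 1 * x + y) + (of_bool (p dvd 1 * x + - y) :: int)" for x
      using split[of x] by (auto simp: of_bool_def)
    then have "(\<Sum>x\<in>residues_p. of_bool (p dvd x\<^sup>2 - k)) =
        (\<Sum>x\<in>residues_p. of_bool (p dvd 1 * x + y)) + (\<Sum>x\<in>residues_p. of_bool (p dvd 1 * x + - y) :: int)"
      by (simp only: sum.distrib)
    also have "\<dots> = 1 + 1"
      by (subst (1 2) sum_affine[of "\<lambda>x. of_bool (p dvd x)"])
        (simp_all only: sum_of_bool_dvd dvd_mod_p_iff not_dvd_1 not_False_eq_True)
    finally show ?thesis using 3 by simp
  qed
qed

lemma sum_of_bool_quadratic:
  assumes "\<not> p dvd a"
  shows "(\<Sum>x\<in>residues_p. of_bool (p dvd a * x\<^sup>2 + b * x + c)) = 1 + chi (b\<^sup>2 - 4 * a * c)"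
proof -
  define k where "k = b\<^sup>2 - 4 * a * c"
  have "p dvd a * x\<^sup>2 + b * x + c \<longleftrightarrow> p dvd (2 * a * x + b)\<^sup>2 - k" for x
  proof -
    have "(2 * a * x + b)\<^sup>2 - k = 4 * (a * (a * x\<^sup>2 + b * x + c))"
      by (simp add: k_def power2_eq_square algebra_simps)
    then show ?thesis using assms not_dvd_4 by (simp add: dvd_mult_iff)
  qed
  then have "(\<Sum>x\<in>residues_p. of_bool (p dvd a * x\<^sup>2 + b * x + c)) =
      (\<Sum>x\<in>residues_p. of_bool (p dvd (2 * a * x + b)\<^sup>2 - k) :: int)"
    by simp
  also have "\<dots> = (\<Sum>x\<in>residues_p. of_bool (p dvd x\<^sup>2 - k))"
  proof (rule sum_affine)
    show "of_bool (p dvd (x mod p)\<^sup>2 - k) = (of_bool (p dvd x\<^sup>2 - k) :: int)" for x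
    proof -
      have "p dvd (x mod p)\<^sup>2 - k - (x\<^sup>2 - k)"
        by (simp add: mod_eq_dvd_iff [symmetric] power_mod)
      from dvd_iff_of_dvd_diff[OF this] show ?thesis by (simp only:)
    qed
    show "\<not> p dvd 2 * a" using assms not_dvd_2 by (simp add: dvd_mult_iff)
  qed
  finally show ?thesis by (simp add: sum_of_bool_square k_def)
qed

text \<open>Double counting of the pairs with y = x^2 modulo p: each y has 1 + chi y square roots,
  each x has one square, so there are p pairs.\<close>

lemma sum_chi: "sum chi residues_p = 0"
proof -
  have "(\<Sum>x\<in>residues_p. of_bool (p dvd x\<^sup>2 - y) :: int) = 1 + chi y" for y
    by (rule sum_of_bool_square)
  then have "(\<Sum>y\<in>residues_p. 1 + chi y) = (\<Sum>y\<in>residues_p. \<Sum>x\<in>residues_p. of_bool (p dvd x\<^sup>2 - y))"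
    by simp
  also have "\<dots> = (\<Sum>x\<in>residues_p. \<Sum>y\<in>residues_p. of_bool (p dvd (-1) * y + x\<^sup>2))"
    by (subst sum.swap) (simp add: algebra_simps)
  also have "\<dots> = (\<Sum>x\<in>residues_p. 1)"
    using p_gt_2 by (subst sum_affine[of "\<lambda>x. of_bool (p dvd x)"])
      (simp_all add: sum_of_bool_dvd)
  finally show ?thesis by (simp add: sum.distrib)
qed

text \<open>For k nonzero modulo p, p plus the sum counts the points of the hyperbola y^2 - x^2 = k.
  With y = u + x the equation becomes u (u + 2 x) = k, linear in x: one solution for each nonzero u
  and none for u = 0, hence p - 1 points.\<close>

lemma sum_chi_square_minus:
  "(\<Sum>y\<in>residues_p. chi (y\<^sup>2 - k)) = (if p dvd k then p - 1 else -1)"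
proof (cases "p dvd k")
  case True
  have "chi (y\<^sup>2 - k) = 1 - of_bool (p dvd y)" for y
  proof -
    have "chi (y\<^sup>2 - k) = chi (y\<^sup>2)" by (rule chi_cong) (use True in simp)
    then show ?thesis
      using chi_power2[of y] chi_eq_0_iff[of "y\<^sup>2"] dvd_power2_iff[of y] by auto
  qed
  then show ?thesis using True p_gt_2 by (simp add: sum_subtractf sum_of_bool_dvd)
next
  case False
  have "(\<Sum>y\<in>residues_p. 1 + chi (y\<^sup>2 - k)) =
      (\<Sum>y\<in>residues_p. \<Sum>x\<in>residues_p. of_bool (p dvd x\<^sup>2 - (y\<^sup>2 - k)))"
    by (simp add: sum_of_bool_square)
  also have "\<dots> = (\<Sum>x\<in>residues_p. \<Sum>y\<in>residues_p. of_bool (p dvd x\<^sup>2 - (y\<^sup>2 - k)))"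
    by (rule sum.swap)
  also have "\<dots> = (\<Sum>x\<in>residues_p. \<Sum>u\<in>residues_p. of_bool (p dvd x\<^sup>2 - ((1 * u + x)\<^sup>2 - k)))"
  proof (rule sum.cong[OF refl], rule sum_affine[symmetric])
    fix x y
    have "p dvd (x\<^sup>2 - ((y mod p)\<^sup>2 - k)) - (x\<^sup>2 - (y\<^sup>2 - k))"
      by (simp add: mod_eq_dvd_iff [symmetric] power_mod)
    from dvd_iff_of_dvd_diff[OF this]
    show "of_bool (p dvd x\<^sup>2 - ((y mod p)\<^sup>2 - k)) = (of_bool (p dvd x\<^sup>2 - (y\<^sup>2 - k)) :: int)"
      by (simp only:)
  qed (rule not_dvd_1)
  also have "\<dots> = (\<Sum>u\<in>residues_p. \<Sum>x\<in>residues_p. of_bool (p dvd x\<^sup>2 - ((1 * u + x)\<^sup>2 - k)))"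
    by (rule sum.swap)
  also have "\<dots> = (\<Sum>u\<in>residues_p. 1 - of_bool (p dvd u))"
  proof (rule sum.cong[OF refl])
    fix u
    have eq: "x\<^sup>2 - ((1 * u + x)\<^sup>2 - k) = (- 2 * u) * x + (k - u\<^sup>2)" for x
      by (simp add: power2_eq_square algebra_simps)
    show "(\<Sum>x\<in>residues_p. of_bool (p dvd x\<^sup>2 - ((1 * u + x)\<^sup>2 - k))) = (1 - of_bool (p dvd u) :: int)"
    proof (cases "p dvd u")
      case True
      have "\<not> p dvd (- 2 * u) * x + (k - u\<^sup>2)" for x
      proof -
        have "p dvd (- 2 * u) * x + (k - u\<^sup>2) - k"
          using True by (simp add: power2_eq_square)
        from dvd_iff_of_dvd_diff[OF this] show ?thesis using False by blast
      qed
      then show ?thesis unfolding eq using True by simp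
    next
      case nu: False
      then have "\<not> p dvd - 2 * u" using not_dvd_2 by (simp add: dvd_mult_iff)
      then have "(\<Sum>x\<in>residues_p. of_bool (p dvd (- 2 * u) * x + (k - u\<^sup>2))) =
          (\<Sum>x\<in>residues_p. of_bool (p dvd x) :: int)"
        by (intro sum_affine[of "\<lambda>x. of_bool (p dvd x)"]) simp_all
      then show ?thesis unfolding eq using nu by (simp only: sum_of_bool_dvd) simp
    qed
  qed
  finally show ?thesis using False p_gt_2 by (simp add: sum.distrib sum_subtractf sum_of_bool_dvd)
qed

text \<open>Multiplication by a unit \<open>a\<close> completes the square, and \<open>chi a\<close>
  is then its own inverse. The case of p dividing \<open>a\<close> is included because the leading
  coefficient of a slice may vanish.\<close>

lemma sum_chi_quadratic:
  "(\<Sum>y\<in>residues_p. chi (a * y\<^sup>2 + 2 * b * y + c)) =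
     (if p dvd a then (if p dvd b then p * chi c else 0)
      else (if p dvd b\<^sup>2 - a * c then p - 1 else -1) * chi a)"
proof (cases "p dvd a")
  case True
  have red: "chi (a * y\<^sup>2 + 2 * b * y + c) = chi (2 * b * y + c)" for y
    by (rule chi_cong) (use True in simp)
  show ?thesis
  proof (cases "p dvd b")
    case b: True
    have "chi (2 * b * y + c) = chi c" for y
      by (rule chi_cong) (use b in simp)
    then show ?thesis using True b p_gt_2 by (simp add: red)
  next
    case False
    then show ?thesis using True not_dvd_2 unfolding red
      by (subst sum_affine[of chi]) (simp_all add: dvd_mult_iff sum_chi)
  qed
next
  case False
  have sq: "chi a * chi (a * y\<^sup>2 + 2 * b * y + c) = chi ((a * y + b)\<^sup>2 - (b\<^sup>2 - a * c))" for y
    by (simp add: chi_mult [symmetric] power2_eq_square algebra_simps)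
  have "chi a * (\<Sum>y\<in>residues_p. chi (a * y\<^sup>2 + 2 * b * y + c)) =
      (\<Sum>y\<in>residues_p. chi ((a * y + b)\<^sup>2 - (b\<^sup>2 - a * c)))"
    by (simp only: sum_distrib_left sq)
  also have "\<dots> = (\<Sum>y\<in>residues_p. chi (y\<^sup>2 - (b\<^sup>2 - a * c)))"
  proof (rule sum_affine[OF _ False])
    show "chi ((y mod p)\<^sup>2 - (b\<^sup>2 - a * c)) = chi (y\<^sup>2 - (b\<^sup>2 - a * c))" for y
      by (rule chi_cong) (simp add: mod_eq_dvd_iff [symmetric] power_mod)
  qed
  also have "\<dots> = (if p dvd b\<^sup>2 - a * c then p - 1 else -1)"
    by (rule sum_chi_square_minus)
  finally have "chi a * (chi a * (\<Sum>y\<in>residues_p. chi (a * y\<^sup>2 + 2 * b * y + c))) =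
      chi a * (if p dvd b\<^sup>2 - a * c then p - 1 else -1)"
    by simp
  moreover have "chi a * chi a = 1"
    using chi_power2[OF False] by (simp add: chi_mult power2_eq_square)
  ultimately show ?thesis using False by (simp add: mult.assoc [symmetric] mult.commute)
qed

end

section \<open>Slices z = const of the equation modulo an odd prime\<close>

locale markov_type_equation = odd_prime_modulus +
  fixes a11 a22 a33 a12 a13 a23 d :: int
  assumes not_dvd_a11: "\<not> p dvd a11" and not_dvd_a22: "\<not> p dvd a22"
    and not_dvd_a33: "\<not> p dvd a33" and not_dvd_d: "\<not> p dvd d"
begin

text \<open>\<open>n1, n2, n3\<close> are the numbers \<open>-A\<^sub>j\<^sub>j\<close>, and \<open>half_det b\<close> is \<open>-1/2\<close> times the determinant of \<open>G\<close>
  with \<open>b\<close> in place of \<open>a12\<close>. If it vanishes, the conic cut out by a plane \<open>z = const\<close>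
  degenerates, and \<open>line_chi\<close> tells whether its two lines are rational.\<close>

abbreviation "n1 \<equiv> a23\<^sup>2 - 4 * a22 * a33"
abbreviation "n2 \<equiv> a13\<^sup>2 - 4 * a11 * a33"
abbreviation "n3 \<equiv> a12\<^sup>2 - 4 * a11 * a22"

definition disc_xy :: "int \<Rightarrow> int" where
  "disc_xy b = b\<^sup>2 - 4 * a11 * a22"

definition half_det :: "int \<Rightarrow> int" where
  "half_det b = a33 * b\<^sup>2 - a13 * a23 * b + (a11 * a23\<^sup>2 + a22 * a13\<^sup>2 - 4 * a11 * a22 * a33)"

definition line_chi :: "int \<Rightarrow> int" where
  "line_chi b = (if p dvd disc_xy b then chi n2 else chi (disc_xy b))"

text \<open>For b = a12 - d z, the polynomial is the discriminant in x of the slice at z, after y is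
  replaced by z y and the factor z^2 is dropped.\<close>

definition slice_sum :: "int \<Rightarrow> int" where
  "slice_sum b =
     (\<Sum>y\<in>residues_p. chi (disc_xy b * y\<^sup>2 + 2 * (b * a13 - 2 * a11 * a23) * y + n2))"

text \<open>The left side is a quarter of the discriminant in y of the polynomial in
  \<open>slice_sum\<close>; as 4 and \<open>a11\<close> are units, it vanishes exactly with
  \<open>half_det b\<close>.\<close>

lemma slice_identity:
  "(b * a13 - 2 * a11 * a23)\<^sup>2 - disc_xy b * n2 = 4 * (a11 * half_det b)"
  by (simp add: disc_xy_def half_det_def power2_eq_square algebra_simps)

text \<open>If p divides \<open>disc_xy b\<close>, the linear coefficient vanishes exactly when
  \<open>half_det b\<close> does, and the constant \<open>n2\<close> remains: the first branch of
  \<open>line_chi\<close>. Otherwise p - 1 = -1 + p yields the second branch.\<close>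

lemma slice_sum_eq:
  "slice_sum b = - chi (disc_xy b) + p * (of_bool (p dvd half_det b) * line_chi b)"
proof -
  define \<beta> where "\<beta> = b * a13 - 2 * a11 * a23"
  have identity: "\<beta>\<^sup>2 - disc_xy b * n2 = 4 * (a11 * half_det b)"
    using slice_identity by (simp add: \<beta>_def)
  have degenerate: "p dvd \<beta>\<^sup>2 - disc_xy b * n2 \<longleftrightarrow> p dvd half_det b"
    using not_dvd_a11 not_dvd_4 by (simp add: identity dvd_mult_iff)
  have "p dvd \<beta> \<longleftrightarrow> p dvd half_det b" if "p dvd disc_xy b"
  proof -
    have "p dvd (\<beta>\<^sup>2 - disc_xy b * n2) - \<beta>\<^sup>2" using that by simp
    from dvd_iff_of_dvd_diff[OF this] show ?thesis
      by (simp only: degenerate dvd_power2_iff)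
  qed
  moreover have "chi (disc_xy b) = 0" if "p dvd disc_xy b"
    using that chi_eq_0_iff by blast
  ultimately show ?thesis
    unfolding slice_sum_def line_chi_def \<beta>_def [symmetric] sum_chi_quadratic
    unfolding degenerate by (auto simp: left_diff_distrib)
qed

lemma sum_chi_disc_xy: "(\<Sum>b\<in>residues_p. chi (disc_xy b)) = -1"
proof -
  have "\<not> p dvd 4 * a11 * a22"
    using not_dvd_a11 not_dvd_a22 not_dvd_4 by (simp add: dvd_mult_iff)
  then show ?thesis by (simp add: disc_xy_def sum_chi_square_minus)
qed

lemma sum_of_bool_half_det:
  "(\<Sum>b\<in>residues_p. of_bool (p dvd half_det b)) = 1 + chi n1 * chi n2"
proof -
  have "(a13 * a23)\<^sup>2 - 4 * a33 * (a11 * a23\<^sup>2 + a22 * a13\<^sup>2 - 4 * a11 * a22 * a33) = n1 * n2"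
    by (simp add: power2_eq_square algebra_simps)
  then show ?thesis
    using sum_of_bool_quadratic[OF not_dvd_a33, of "- (a13 * a23)"
        "a11 * a23\<^sup>2 + a22 * a13\<^sup>2 - 4 * a11 * a22 * a33"]
    by (simp add: half_det_def chi_mult)
qed

text \<open>At a root of \<open>half_det\<close>, \<open>slice_identity\<close> makes
  \<open>disc_xy b * n2\<close> a square modulo p.\<close>

lemma line_chi_eq_chi_n2:
  assumes "p dvd half_det b" "\<not> p dvd n2"
  shows "line_chi b = chi n2"
proof (cases "p dvd disc_xy b")
  case False
  have "p dvd (b * a13 - 2 * a11 * a23)\<^sup>2 - disc_xy b * n2"
    using assms(1) by (simp add: slice_identity)
  then have "p dvd disc_xy b * n2 - (b * a13 - 2 * a11 * a23)\<^sup>2"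
    by (simp add: dvd_diff_commute)
  then show ?thesis
    using chi_eq_of_mult_square False assms(2) by (simp add: line_chi_def)
qed (simp add: line_chi_def)

text \<open>If \<open>n1 * n2\<close> vanishes, then \<open>half_det\<close> has a double root, at which \<open>disc_xy\<close> can be
  computed up to squares.\<close>

lemma line_chi_at_double_root:
  assumes root: "p dvd half_det b" and "p dvd n1 \<or> p dvd n2"
  shows "line_chi b = chi n1 + chi n2"
proof -
  have "(2 * a33 * b - a13 * a23)\<^sup>2 = 4 * a33 * half_det b + n1 * n2"
    by (simp add: half_det_def power2_eq_square algebra_simps)
  then have "p dvd (2 * a33 * b - a13 * a23)\<^sup>2"
    using assms by auto
  then have vertex: "p dvd 2 * a33 * b - a13 * a23"
    by (simp only: dvd_power2_iff)
  show ?thesis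
  proof (cases "p dvd n2")
    case n2: True
    then have "chi n2 = 0" by (simp only: chi_eq_0_iff)
    then have "line_chi b = chi (disc_xy b)"
      using chi_eq_0_iff[of "disc_xy b"] by (simp add: line_chi_def)
    moreover have "chi (disc_xy b) = chi n1"
    proof (rule chi_eqI)
      \<comment> \<open>Obtained by substituting 2 a33 b = a13 a23 (from \<open>vertex\<close>) and
        4 a11 a33 = a13^2 (from \<open>n2\<close>) modulo p.\<close>
      have "(2 * a33)\<^sup>2 * disc_xy b - a13\<^sup>2 * n1 =
          (2 * a33 * b - a13 * a23) * (2 * a33 * b + a13 * a23) + 4 * a22 * a33 * n2"
        by (simp add: disc_xy_def power2_eq_square algebra_simps)
      then show "p dvd (2 * a33)\<^sup>2 * disc_xy b - a13\<^sup>2 * n1"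
        using vertex n2 by simp
      show "\<not> p dvd 2 * a33" using not_dvd_2 not_dvd_a33 by (simp add: dvd_mult_iff)
      have "p dvd a13\<^sup>2 \<longleftrightarrow> p dvd 4 * a11 * a33" by (rule dvd_iff_of_dvd_diff[OF n2])
      then show "\<not> p dvd a13"
        using not_dvd_4 not_dvd_a11 not_dvd_a33 by (simp add: dvd_mult_iff dvd_power2_iff)
    qed
    ultimately show ?thesis using \<open>chi n2 = 0\<close> by simp
  next
    case False
    then have "p dvd n1" using assms by blast
    then have "chi n1 = 0" by (simp only: chi_eq_0_iff)
    then show ?thesis using line_chi_eq_chi_n2[OF root False] by simp
  qed
qed

text \<open>If p divides \<open>n1\<close> or \<open>n2\<close>, there is a single root, with known
  value. Otherwise each of the 1 + chi n1 * chi n2 roots contributes \<open>chi n2\<close>, whose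
  square is 1.\<close>

lemma sum_line_chi:
  "(\<Sum>b\<in>residues_p. of_bool (p dvd half_det b) * line_chi b) = chi n1 + chi n2"
proof (cases "p dvd n1 \<or> p dvd n2")
  case True
  have "(\<Sum>b\<in>residues_p. of_bool (p dvd half_det b) * line_chi b) =
      (\<Sum>b\<in>residues_p. of_bool (p dvd half_det b) * (chi n1 + chi n2))"
    using line_chi_at_double_root[OF _ True] by (intro sum.cong) auto
  also have "\<dots> = (1 + chi n1 * chi n2) * (chi n1 + chi n2)"
    by (simp only: sum_distrib_right [symmetric] sum_of_bool_half_det)
  also have "chi n1 * chi n2 = 0"
    using True chi_eq_0_iff[of n1] chi_eq_0_iff[of n2] by auto
  finally show ?thesis by simp
next
  case False
  have "(\<Sum>b\<in>residues_p. of_bool (p dvd half_det b) * line_chi b) =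
      (\<Sum>b\<in>residues_p. of_bool (p dvd half_det b) * chi n2)"
    using line_chi_eq_chi_n2 False by (intro sum.cong) auto
  also have "\<dots> = (1 + chi n1 * chi n2) * chi n2"
    by (simp only: sum_distrib_right [symmetric] sum_of_bool_half_det)
  also have "\<dots> = chi n1 + chi n2"
    using False chi_cases[of n2] chi_eq_0_iff[of n2] by auto
  finally show ?thesis .
qed

section \<open>Summation over all slices\<close>

lemma slice_sum_mod: "slice_sum (b mod p) = slice_sum b"
  unfolding slice_sum_def
proof (intro sum.cong refl chi_cong)
  fix y
  have "[disc_xy (b mod p) * y\<^sup>2 + 2 * ((b mod p) * a13 - 2 * a11 * a23) * y + n2
      = disc_xy b * y\<^sup>2 + 2 * (b * a13 - 2 * a11 * a23) * y + n2] (mod p)"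
    unfolding disc_xy_def
    by (intro cong_add cong_mult cong_diff cong_pow cong_refl cong_mod_p)
  then show "p dvd disc_xy (b mod p) * y\<^sup>2 + 2 * ((b mod p) * a13 - 2 * a11 * a23) * y + n2
      - (disc_xy b * y\<^sup>2 + 2 * (b * a13 - 2 * a11 * a23) * y + n2)"
    by (simp only: cong_iff_dvd_diff)
qed

lemma sum_slice_sum: "sum slice_sum residues_p = 1 + p * (chi n1 + chi n2)"
  unfolding slice_sum_eq
  by (simp only: sum.distrib sum_negf sum_distrib_left [symmetric] sum_chi_disc_xy sum_line_chi)

text \<open>The cubic term joins the coefficient of x, so the equation stays quadratic in x.\<close>

definition disc_x :: "int \<Rightarrow> int \<Rightarrow> int" where
  "disc_x y z = ((a12 - d * z) * y + a13 * z)\<^sup>2 - 4 * a11 * (a22 * y\<^sup>2 + a23 * y * z + a33 * z\<^sup>2)"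

lemma sum_chi_disc_x_0: "(\<Sum>y\<in>residues_p. chi (disc_x y 0)) = (p - 1) * chi n3"
proof -
  \<comment> \<open>The zero terms match \<open>sum_chi_quadratic\<close> with b = c = 0, the
    degenerate case.\<close>
  have "(\<Sum>y\<in>residues_p. chi (disc_x y 0)) = (\<Sum>y\<in>residues_p. chi (n3 * y\<^sup>2 + 2 * 0 * y + 0))"
    by (simp add: disc_x_def power2_eq_square algebra_simps)
  also have "\<dots> = (p - 1) * chi n3"
    unfolding sum_chi_quadratic using chi_eq_0_iff[of n3] by (auto simp: Legendre_def cong_def)
  finally show ?thesis .
qed

lemma sum_chi_disc_x:
  assumes "\<not> p dvd z"
  shows "(\<Sum>y\<in>residues_p. chi (disc_x y z)) = slice_sum (a12 - d * z)"
proof -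
  have "(\<Sum>y\<in>residues_p. chi (disc_x y z)) = (\<Sum>y\<in>residues_p. chi (disc_x (z * y + 0) z))"
  proof (rule sum_affine [OF _ assms, symmetric], rule chi_cong)
    fix y
    have "[disc_x (y mod p) z = disc_x y z] (mod p)"
      unfolding disc_x_def by (intro cong_add cong_mult cong_diff cong_pow cong_refl cong_mod_p)
    then show "p dvd disc_x (y mod p) z - disc_x y z" by (simp only: cong_iff_dvd_diff)
  qed
  also have "\<dots> = (\<Sum>y\<in>residues_p. chi (z\<^sup>2 * (disc_xy (a12 - d * z) * y\<^sup>2 +
      2 * ((a12 - d * z) * a13 - 2 * a11 * a23) * y + n2)))"
    unfolding disc_x_def disc_xy_def
    by (intro sum.cong arg_cong[where f = chi] refl) (simp add: power2_eq_square algebra_simps)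
  also have "\<dots> = slice_sum (a12 - d * z)"
    unfolding chi_mult chi_power2[OF assms] slice_sum_def by simp
  finally show ?thesis .
qed

text \<open>As z runs over the nonzero residues, a12 - d z misses only the class of
  \<open>a12\<close>, so \<open>slice_sum a12\<close> is subtracted from the full sum. Its term -
  chi n3 completes the (p - 1) chi n3 of the slice z = 0 to p chi n3.\<close>

lemma sum_sum_chi_disc_x:
  "(\<Sum>z\<in>residues_p. \<Sum>y\<in>residues_p. chi (disc_x y z)) =
     p * (chi n1 + chi n2 + chi n3 - of_bool (p dvd half_det a12) * line_chi a12) + 1"
proof -
  have split: "sum f residues_p = f 0 + sum f (residues_p - {0})" for f :: "int \<Rightarrow> int"
    using p_gt_2 by (intro sum.remove) auto
  have "(\<Sum>z\<in>residues_p - {0}. \<Sum>y\<in>residues_p. chi (disc_x y z)) =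
      (\<Sum>z\<in>residues_p - {0}. slice_sum (a12 - d * z))"
    using zdvd_not_zless by (intro sum.cong refl sum_chi_disc_x) fastforce
  also have "\<dots> = (\<Sum>z\<in>residues_p. slice_sum ((- d) * z + a12)) - slice_sum a12"
    using split[of "\<lambda>z. slice_sum (a12 - d * z)"] by (simp add: algebra_simps)
  also have "(\<Sum>z\<in>residues_p. slice_sum ((- d) * z + a12)) = sum slice_sum residues_p"
    using not_dvd_d by (intro sum_affine slice_sum_mod) simp
  finally have "(\<Sum>z\<in>residues_p - {0}. \<Sum>y\<in>residues_p. chi (disc_x y z)) =
      1 + p * (chi n1 + chi n2) - slice_sum a12"
    by (simp only: sum_slice_sum)
  moreover have "slice_sum a12 = - chi n3 + p * (of_bool (p dvd half_det a12) * line_chi a12)"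
    by (simp only: slice_sum_eq disc_xy_def)
  moreover have "X = 1 + p * (u + v) - S \<Longrightarrow> S = - w + p * e \<Longrightarrow>
      (p - 1) * w + X = p * (u + v + w - e) + 1" for X S u v w e
    by (simp add: algebra_simps)
  ultimately show ?thesis
    unfolding split[of "\<lambda>z. \<Sum>y\<in>residues_p. chi (disc_x y z)"] sum_chi_disc_x_0 by blast
qed

lemma card_solutions:
  "int (card (solutions_mod a11 a22 a33 a12 a13 a23 d (nat p))) =
     p\<^sup>2 + p * (chi n1 + chi n2 + chi n3 - of_bool (p dvd half_det a12) * line_chi a12) + 1"
proof -
  let ?Q = "\<lambda>x y z. a11 * x\<^sup>2 + a22 * y\<^sup>2 + a33 * z\<^sup>2 + a12 * x * y + a13 * x * z + a23 * y * z
    - d * x * y * z"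
  have "int (card (solutions_mod a11 a22 a33 a12 a13 a23 d (nat p))) =
      (\<Sum>x\<in>residues_p. \<Sum>y\<in>residues_p. \<Sum>z\<in>residues_p. of_bool (p dvd ?Q x y z))"
    using p_gt_2 by (simp only: card_solutions_mod_eq_sum) simp
  also have "\<dots> = (\<Sum>y\<in>residues_p. \<Sum>x\<in>residues_p. \<Sum>z\<in>residues_p. of_bool (p dvd ?Q x y z))"
    by (rule sum.swap)
  also have "\<dots> = (\<Sum>y\<in>residues_p. \<Sum>z\<in>residues_p. \<Sum>x\<in>residues_p. of_bool (p dvd ?Q x y z))"
    by (intro sum.cong refl sum.swap)
  also have "\<dots> = (\<Sum>z\<in>residues_p. \<Sum>y\<in>residues_p. \<Sum>x\<in>residues_p. of_bool (p dvd ?Q x y z))"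
    by (rule sum.swap)
  also have "\<dots> = (\<Sum>z\<in>residues_p. \<Sum>y\<in>residues_p. 1 + chi (disc_x y z))"
  proof (intro sum.cong refl)
    fix y z
    have "?Q x y z = a11 * x\<^sup>2 + ((a12 - d * z) * y + a13 * z) * x
        + (a22 * y\<^sup>2 + a23 * y * z + a33 * z\<^sup>2)" for x
      by (simp add: algebra_simps)
    then show "(\<Sum>x\<in>residues_p. of_bool (p dvd ?Q x y z)) = 1 + chi (disc_x y z)"
      by (simp only: sum_of_bool_quadratic[OF not_dvd_a11] disc_x_def)
  qed
  also have "\<dots> = p\<^sup>2 + (\<Sum>z\<in>residues_p. \<Sum>y\<in>residues_p. chi (disc_x y z))"
    using p_gt_2 by (simp add: sum.distrib power2_eq_square)
  finally show ?thesis by (simp add: sum_sum_chi_disc_x)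
qed

section \<open>The singular case\<close>

text \<open>Jacobi's identity: a principal 2 by 2 minor of the adjugate of \<open>G\<close> is det G
  times the complementary diagonal entry of \<open>G\<close>.\<close>

lemma adjugate_identities:
  "n1 * n3 - (a12 * a23 - 2 * a22 * a13)\<^sup>2 = - (4 * a22 * half_det a12)"
  "n2 * n3 - (a12 * a13 - 2 * a11 * a23)\<^sup>2 = - (4 * a11 * half_det a12)"
  "n1 * n2 - (a13 * a23 - 2 * a33 * a12)\<^sup>2 = - (4 * a33 * half_det a12)"
  by (simp_all add: half_det_def power2_eq_square algebra_simps)

text \<open>This makes the index j in the third case arbitrary. As \<open>line_chi\<close> does not
  involve \<open>n1\<close>, that value is reached through a nonvanishing \<open>n2\<close> or
  \<open>n3\<close>.\<close>

lemma line_chi_a12_eq: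
  assumes "p dvd half_det a12"
  shows "\<not> p dvd n3 \<Longrightarrow> line_chi a12 = chi n3"
    and "\<not> p dvd n2 \<Longrightarrow> line_chi a12 = chi n2"
    and "\<not> p dvd n1 \<Longrightarrow> \<not> (p dvd n2 \<and> p dvd n3) \<Longrightarrow> line_chi a12 = chi n1"
proof -
  show n3: "line_chi a12 = chi n3" if "\<not> p dvd n3"
    using that by (simp add: line_chi_def disc_xy_def)
  show n2: "line_chi a12 = chi n2" if "\<not> p dvd n2"
    using line_chi_eq_chi_n2 assms that by simp
  show "line_chi a12 = chi n1" if n1: "\<not> p dvd n1" and "\<not> (p dvd n2 \<and> p dvd n3)"
  proof (cases "p dvd n3")
    case False
    have "p dvd n1 * n3 - (a12 * a23 - 2 * a22 * a13)\<^sup>2"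
      unfolding adjugate_identities using assms by simp
    then show ?thesis using chi_eq_of_mult_square n1 n3 False by simp
  next
    case True
    then have "\<not> p dvd n2" using that by blast
    moreover have "p dvd n1 * n2 - (a13 * a23 - 2 * a33 * a12)\<^sup>2"
      unfolding adjugate_identities using assms by simp
    ultimately show ?thesis using chi_eq_of_mult_square n1 n2 by simp
  qed
qed

text \<open>A null vector \<open>v\<close> of \<open>G\<close> gives \<open>A\<^sub>j\<^sub>j\<close> proportional to the square of \<open>v\<^sub>j\<close>, and since
  the diagonal of \<open>G\<close> is nonzero, \<open>v\<close> is no multiple of a unit vector.\<close>

lemma minors_vanish_aux:
  assumes "p dvd b12 * b13 - 2 * b11 * b23" "p dvd b13\<^sup>2 - 4 * b11 * b33" "p dvd b12\<^sup>2 - 4 * b11 * b22"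
    and "\<not> p dvd b11"
  shows "p dvd b23\<^sup>2 - 4 * b22 * b33"
proof -
  have "4 * (b11\<^sup>2 * (b23\<^sup>2 - 4 * b22 * b33)) =
      b13\<^sup>2 * (b12\<^sup>2 - 4 * b11 * b22) + 4 * b11 * b22 * (b13\<^sup>2 - 4 * b11 * b33)
      - (b12 * b13 - 2 * b11 * b23) * (b12 * b13 + 2 * b11 * b23)"
    by (simp add: power2_eq_square algebra_simps)
  then have "p dvd 4 * (b11\<^sup>2 * (b23\<^sup>2 - 4 * b22 * b33))"
    using assms by simp
  then show ?thesis using not_dvd_4 assms(4) by (simp only: dvd_mult_iff dvd_power2_iff simp_thms)
qed

lemma minors_vanish:
  assumes "p dvd half_det a12"
  shows "p dvd n2 \<Longrightarrow> p dvd n3 \<Longrightarrow> p dvd n1"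
    and "p dvd n1 \<Longrightarrow> p dvd n3 \<Longrightarrow> p dvd n2"
    and "p dvd n1 \<Longrightarrow> p dvd n2 \<Longrightarrow> p dvd n3"
proof -
  \<comment> \<open>A vanishing diagonal entry of the adjugate forces the off-diagonal entries in
    its row to vanish.\<close>
  have sq: "p dvd w" if "u * v - w\<^sup>2 = - (4 * a * half_det a12)" "p dvd u" for u v w a
  proof -
    have "p dvd u * v - w\<^sup>2" using assms by (simp add: that(1))
    from dvd_iff_of_dvd_diff[OF this] show ?thesis using that(2) dvd_power2_iff by simp
  qed
  show "p dvd n1" if "p dvd n2" "p dvd n3"
    using minors_vanish_aux[OF sq[OF adjugate_identities(2)]] that not_dvd_a11 by blast
  \<comment> \<open>The same elimination with permuted indices: \<open>a22\<close>, and below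
    \<open>a33\<close>, takes the place of \<open>b11\<close>.\<close>
  show "p dvd n2" if "p dvd n1" "p dvd n3"
    using minors_vanish_aux[OF sq[OF adjugate_identities(1)], of a33 a11] that not_dvd_a22
    by (simp add: algebra_simps)
  show "p dvd n3" if "p dvd n1" "p dvd n2"
    using minors_vanish_aux[OF sq[OF adjugate_identities(3)], of a22 a11] that not_dvd_a33
    by (simp add: algebra_simps)
qed

lemma line_chi_a12_eq_0:
  assumes "p dvd n2" "p dvd n3"
  shows "line_chi a12 = 0"
  using assms chi_eq_0_iff[of n2] by (simp add: line_chi_def disc_xy_def)

end

theorem theorem1p6:
  fixes a11 a22 a33 a12 a13 a23 d :: int and p :: nat
  assumes "prime p" and "\<not> int p dvd a11 * a22 * a33 * d"
  shows "let A = diag_minors a11 a22 a33 a12 a13 a23;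
             D = det (coeff_matrix a11 a22 a33 a12 a13 a23);
             N = int (card (solutions_mod a11 a22 a33 a12 a13 a23 d p));
             S = Legendre (- (A $ 1)) (int p) + Legendre (- (A $ 2)) (int p)
                 + Legendre (- (A $ 3)) (int p)
         in (\<not> int p dvd D \<longrightarrow> p > 2 \<and> N = (int p)\<^sup>2 + S * int p + 1) \<and>
            (p > 2 \<and> int p dvd D \<and> card {j. int p dvd A $ j} \<ge> 2 \<longrightarrow> N = (int p)\<^sup>2 + 1) \<and>
            (p > 2 \<and> int p dvd D \<and> card {j. int p dvd A $ j} \<le> 1 \<longrightarrow>
               (\<forall>j. \<not> int p dvd A $ j \<longrightarrow>
                  N = (int p)\<^sup>2 + (S - Legendre (- (A $ j)) (int p)) * int p + 1)) \<and>
            (p = 2 \<and> int p dvd D \<longrightarrow>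
               N = (if even a12 \<and> even a13 \<and> even a23 then 5
                    else if odd a12 \<and> odd a13 \<and> odd a23 then 1
                    else 3))"
proof -
  define A where "A = diag_minors a11 a22 a33 a12 a13 a23"
  define D where "D = det (coeff_matrix a11 a22 a33 a12 a13 a23)"
  define N where "N = int (card (solutions_mod a11 a22 a33 a12 a13 a23 d p))"
  define S where "S = Legendre (- (A $ 1)) (int p) + Legendre (- (A $ 2)) (int p)
      + Legendre (- (A $ 3)) (int p)"
  note defs = A_def D_def N_def S_def
  have coeffs: "\<not> int p dvd a11" "\<not> int p dvd a22" "\<not> int p dvd a33" "\<not> int p dvd d"
    using assms(2) by auto
  have "even D" by (simp add: D_def det_coeff_matrix)
  consider "p = 2" | "p > 2"
    using assms(1) prime_ge_2_nat[of p] by linarith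
  then show ?thesis
  proof cases
    case 1
    have "N = (if even a12 \<and> even a13 \<and> even a23 then 5
        else if odd a12 \<and> odd a13 \<and> odd a23 then 1 else 3)"
      unfolding N_def 1 by (rule card_solutions_mod_2) (use coeffs 1 in simp_all)
    then show ?thesis
      unfolding Let_def defs [symmetric] using 1 \<open>even D\<close> by simp
  next
    case 2
    interpret markov_type_equation "int p" a11 a22 a33 a12 a13 a23 d
      by unfold_locales (use assms(1) 2 coeffs in simp_all)
    have minus_A: "- (A $ 1) = n1" "- (A $ 2) = n2" "- (A $ 3) = n3"
      by (simp_all add: A_def diag_minors_def)
    have dvd_A: "int p dvd A $ 1 \<longleftrightarrow> int p dvd n1" "int p dvd A $ 2 \<longleftrightarrow> int p dvd n2"
        "int p dvd A $ 3 \<longleftrightarrow> int p dvd n3"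
      by (simp_all only: minus_A [symmetric] dvd_minus_iff)
    have "D = - (2 * half_det a12)"
      by (simp add: D_def det_coeff_matrix half_det_def)
    then have D: "int p dvd D \<longleftrightarrow> int p dvd half_det a12"
      using not_dvd_2 by (simp add: dvd_mult_iff)
    have S: "S = chi n1 + chi n2 + chi n3"
      by (simp only: S_def minus_A)
    have N: "N = (int p)\<^sup>2 + (S - of_bool (int p dvd D) * line_chi a12) * int p + 1"
      using card_solutions unfolding N_def S D by (simp add: mult.commute)
    have "N = (int p)\<^sup>2 + 1" if "int p dvd D" "card {j. int p dvd A $ j} \<ge> 2"
    proof -
      \<comment> \<open>Two vanishing minors force the third by
        \<open>minors_vanish\<close>.\<close>
      have all: "int p dvd n1" "int p dvd n2" "int p dvd n3"
        using that minors_vanish unfolding card_Collect_3 dvd_A D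
        by (auto simp: of_bool_def split: if_splits)
      then have "chi n1 = 0" "chi n2 = 0" "chi n3 = 0"
        by (simp_all only: chi_eq_0_iff)
      then have "S = 0" by (simp only: S)
      moreover have "line_chi a12 = 0" using all by (intro line_chi_a12_eq_0)
      ultimately show ?thesis using N by simp
    qed
    moreover have "line_chi a12 = chi (- (A $ j))"
      if "int p dvd D" "card {j. int p dvd A $ j} \<le> 1" "\<not> int p dvd A $ j" for j
    proof -
      have "\<not> (int p dvd n2 \<and> int p dvd n3)"
        using that(2) unfolding card_Collect_3 dvd_A by auto
      note line_chi_a12_eq = line_chi_a12_eq(1,2) line_chi_a12_eq(3)[OF _ _ this]
      consider "j = 1" | "j = 2" | "j = 3" using exhaust_3 by blast
      then show ?thesis
        by cases (use that(1,3) line_chi_a12_eq in \<open>simp_all only: D minus_A dvd_A simp_thms\<close>)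
    qed
    ultimately show ?thesis
      unfolding Let_def defs [symmetric] using 2 N by simp
  qed
qed

end
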